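(* The normed hexablock $\mathbb H_N$ is a proper subset of the $\mu$-hexablock $\mathbb H_\mu$.
   Context: $\|\cdot\|$ is the operator norm on $M_2(\mathbb C)$ induced by the Euclidean norm on $\mathbb C^2$. Let $E\subset M_2(\mathbb C)$ be the linear space of all upper triangular matrices. For $A\in M_2(\mathbb C)$, $$\mu_{\mathrm{hexa}}(A)=\frac{1}{\inf\{\|X\| : X\in E,\ \det(I-AX)=0\}},$$ with $\mu_{\mathrm{hexa}}(A)=0$ if $\det(I-AX)\ne0$ for all $X\in E$. $\pi:M_2(\mathbb C)\to\mathbb C^4$ is $\pi((a_{ij}))=(a_{21},a_{11},a_{22},\det(A))$. The $\mu$-hexablock is $\mathbb H_\mu=\{\pi(A): A\in M_2(\mathbb C),\ \mu_{\mathrm{hexa}}(A)<1\}$ and the normed hexablock is $\mathbb H_N=\{\pi(A): A\in M_2(\mathbb C),\ \|A\|<1\}$. *)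

theory Defs
  imports "HOL-Analysis.Analysis"
begin

(* complex^2 carries the Euclidean norm, so this is the induced operator norm.
   (The library norm on complex^2^2 is the Frobenius norm.) *)
definition op_norm :: "complex^2^2 \<Rightarrow> real" where
  "op_norm A = onorm (\<lambda>x. A *v x)"

(* The index type 2 is arithmetic modulo 2 (2 = 0 there), so its order does not
   reflect the numbering of rows and columns; the entry below the diagonal is
   therefore named explicitly. *)
definition upper_tri :: "(complex^2^2) set" where
  "upper_tri = {X. X $ 2 $ 1 = 0}"

definition mu_hexa :: "complex^2^2 \<Rightarrow> real" where
  "mu_hexa A =
    (if \<forall>X \<in> upper_tri. det (mat 1 - A ** X) \<noteq> 0 then 0
     else 1 / Inf {op_norm X | X. X \<in> upper_tri \<and> det (mat 1 - A ** X) = 0})"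

definition hexa_pi :: "complex^2^2 \<Rightarrow> complex^4" where
  "hexa_pi A = vector [A $ 2 $ 1, A $ 1 $ 1, A $ 2 $ 2, det A]"

lemma hexa_pi_nth:
  "hexa_pi A $ 1 = A $ 2 $ 1" "hexa_pi A $ 2 = A $ 1 $ 1"
  "hexa_pi A $ 3 = A $ 2 $ 2" "hexa_pi A $ 4 = det A"
  by (simp_all add: hexa_pi_def vector_def)

definition mu_hexablock :: "(complex^4) set" where
  "mu_hexablock = {hexa_pi A | A. mu_hexa A < 1}"

definition normed_hexablock :: "(complex^4) set" where
  "normed_hexablock = {hexa_pi A | A. op_norm A < 1}"

end

theory Submission
  imports Defs
begin

text \<open>
  For the inclusion, \<open>det (I - A X) = 0\<close> gives a nonzero vector fixed by \<open>A X\<close>, so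
  \<open>1 \<le> \<parallel>A\<parallel> \<parallel>X\<parallel>\<close>: when \<open>\<parallel>A\<parallel> < 1\<close>, every \<open>X\<close> making \<open>I - A X\<close> singular has norm
  at least \<open>1 / \<parallel>A\<parallel> > 1\<close> (none exists for \<open>A = 0\<close>), whence \<open>\<mu>(A) < 1\<close>.
  Thus the same matrix witnesses membership in both sets.

  For strictness, note that \<open>\<pi>\<close> forgets only the entry \<open>a\<^sub>1\<^sub>2\<close>, and that the determinant
  recovers it as soon as \<open>a\<^sub>2\<^sub>1 \<noteq> 0\<close>.  It therefore suffices to find a single matrix with
  \<open>a\<^sub>2\<^sub>1 \<noteq> 0\<close>, \<open>\<mu>(A) < 1\<close> and \<open>\<parallel>A\<parallel> \<ge> 1\<close>.  If the diagonal vanishes, singularity of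
  \<open>I - A X\<close> with \<open>X\<close> upper triangular reads \<open>1 = a\<^sub>2\<^sub>1 x\<^sub>1\<^sub>2 + a\<^sub>1\<^sub>2 a\<^sub>2\<^sub>1 x\<^sub>1\<^sub>1 x\<^sub>2\<^sub>2\<close>, so a small
  \<open>a\<^sub>2\<^sub>1\<close> forces \<open>X\<close> to be large even though \<open>a\<^sub>1\<^sub>2 = 1\<close> keeps \<open>\<parallel>A\<parallel> \<ge> 1\<close>.
\<close>

lemma norm_matrix_vector_le_op_norm: "norm (A *v x) \<le> op_norm A * norm x"
proof -
  have "linear (\<lambda>x. A *v x)"
    by (intro linearI)
      (simp_all add: vec_eq_iff matrix_vector_mult_def scaleR_sum_right
        distrib_left sum.distrib)
  then show ?thesis
    unfolding op_norm_def by (intro onorm) (simp add: linear_conv_bounded_linear)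
qed

lemma norm_entry_le_op_norm: "norm (A $ i $ j) \<le> op_norm A"
proof -
  have "norm (A $ i $ j) = norm ((A *v axis j 1) $ i)"
    by (simp add: matrix_vector_mult_def axis_def if_distrib cong: if_cong)
  also have "\<dots> \<le> norm (A *v axis j 1)"
    by (rule Finite_Cartesian_Product.norm_nth_le)
  also have "\<dots> \<le> op_norm A"
    using norm_matrix_vector_le_op_norm[of A "axis j 1"] by simp
  finally show ?thesis .
qed

lemma op_norm_nonneg: "0 \<le> op_norm A"
  using norm_entry_le_op_norm[of A 1 1] norm_ge_zero order_trans by blast

text \<open>This is the half of the small gain theorem saying that a perturbation must have norm at
  least the reciprocal of \<open>\<parallel>A\<parallel>\<close> to make \<open>I - A X\<close> singular: evaluate norms along a fixed
  vector of \<open>A X\<close>.\<close>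

lemma op_norm_mult_ge_1_if_singular:
  assumes "det (mat 1 - A ** X) = 0"
  shows "1 \<le> op_norm A * op_norm X"
proof -
  have "\<not> invertible (mat 1 - A ** X)"
    using assms by (simp add: invertible_det_nz)
  then obtain v where v: "v \<noteq> 0" "(mat 1 - A ** X) *v v = 0"
    using matrix_left_invertible_ker[of "mat 1 - A ** X"] invertible_left_inverse by blast
  have "A *v (X *v v) = v"
    using v(2) by (simp add: matrix_vector_mult_diff_rdistrib matrix_vector_mul_assoc)
  then have "norm v \<le> op_norm A * norm (X *v v)"
    using norm_matrix_vector_le_op_norm[of A "X *v v"] by simp
  also have "\<dots> \<le> op_norm A * (op_norm X * norm v)"
    by (intro mult_left_mono norm_matrix_vector_le_op_norm op_norm_nonneg)
  finally have "1 * norm v \<le> (op_norm A * op_norm X) * norm v"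
    by simp
  then show ?thesis
    using v(1) by (simp only: mult_le_cancel_right) simp
qed

text \<open>A uniform bound is needed: the infimum of numbers that each exceed 1 may equal 1.\<close>

lemma mu_hexa_less_1I:
  assumes "1 < c"
    and "\<And>X. X \<in> upper_tri \<Longrightarrow> det (mat 1 - A ** X) = 0 \<Longrightarrow> c \<le> op_norm X"
  shows "mu_hexa A < 1"
proof (cases "\<forall>X \<in> upper_tri. det (mat 1 - A ** X) \<noteq> 0")
  case True
  then show ?thesis by (simp add: mu_hexa_def)
next
  case False
  then have "c \<le> Inf {op_norm X | X. X \<in> upper_tri \<and> det (mat 1 - A ** X) = 0}"
    using assms(2) by (intro cInf_greatest) auto
  then show ?thesis
    using False assms(1) by (auto simp: mu_hexa_def)
qed

lemma mu_hexa_less_1_if_op_norm_less_1: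
  assumes "op_norm A < 1"
  shows "mu_hexa A < 1"
proof (cases "op_norm A = 0")
  case True
  \<comment> \<open>Here \<open>I - A X\<close> is never singular, so any constant above 1 serves as the bound.\<close>
  show ?thesis
    by (rule mu_hexa_less_1I[of 2]) (use True op_norm_mult_ge_1_if_singular[of A] in force)+
next
  case False
  then have pos: "0 < op_norm A"
    using op_norm_nonneg[of A] by linarith
  show ?thesis
  proof (rule mu_hexa_less_1I)
    show "1 < 1 / op_norm A"
      using pos assms by simp
    show "1 / op_norm A \<le> op_norm X" if "det (mat 1 - A ** X) = 0" for X
      using op_norm_mult_ge_1_if_singular[OF that] pos
      by (simp add: divide_le_eq mult.commute)
  qed
qed

lemma hexa_pi_inj_if_lower_left_nonzero:
  assumes "hexa_pi A = hexa_pi B" and "A $ 2 $ 1 \<noteq> 0"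
  shows "A = B"
proof -
  have entries: "A $ 2 $ 1 = B $ 2 $ 1" "A $ 1 $ 1 = B $ 1 $ 1" "A $ 2 $ 2 = B $ 2 $ 2"
    and "det A = det B"
    using assms(1) by (metis hexa_pi_nth)+
  then have "A $ 1 $ 2 = B $ 1 $ 2"
    using assms(2) by (simp add: det_2)
  with entries show ?thesis
    by (simp add: vec_eq_iff forall_2)
qed

definition separating_matrix :: "complex^2^2" where
  "separating_matrix = vector [vector [0, 1], vector [1/4, 0]]"

lemma separating_matrix_nth:
  "separating_matrix $ 1 $ 1 = 0" "separating_matrix $ 1 $ 2 = 1"
  "separating_matrix $ 2 $ 1 = 1/4" "separating_matrix $ 2 $ 2 = 0"
  by (simp_all add: separating_matrix_def vector_2)

lemma op_norm_separating_matrix_ge_1: "1 \<le> op_norm separating_matrix"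
  using norm_entry_le_op_norm[of separating_matrix 1 2] by (simp add: separating_matrix_nth)

lemma mu_hexa_separating_matrix: "mu_hexa separating_matrix < 1"
proof (rule mu_hexa_less_1I[of "3/2"])
  fix X assume X: "X \<in> upper_tri" "det (mat 1 - separating_matrix ** X) = 0"
  show "3/2 \<le> op_norm X"
  proof (rule ccontr)
    assume "\<not> 3/2 \<le> op_norm X"
    then have small: "norm (X $ i $ j) \<le> 3/2" for i j
      using norm_entry_le_op_norm[of X i j] by linarith
    have "1 = X $ 1 $ 2 / 4 + X $ 1 $ 1 * X $ 2 $ 2 / 4"
      using X by (simp add: det_2 upper_tri_def matrix_matrix_mult_def mat_def sum_2
          separating_matrix_nth algebra_simps)
    then have "1 = norm (X $ 1 $ 2 / 4 + X $ 1 $ 1 * X $ 2 $ 2 / 4)"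
      by (metis norm_one)
    also have "\<dots> \<le> norm (X $ 1 $ 2) / 4 + norm (X $ 1 $ 1) * norm (X $ 2 $ 2) / 4"
      by (rule norm_triangle_le) (simp add: norm_divide norm_mult)
    also have "\<dots> \<le> (3/2) / 4 + (3/2) * (3/2) / 4"
      by (intro add_mono divide_right_mono mult_mono small) auto
    finally show False by simp
  qed
qed simp

theorem theorem4p2:
  shows "normed_hexablock \<subset> mu_hexablock"
proof (rule psubsetI)
  show "normed_hexablock \<subseteq> mu_hexablock"
    unfolding normed_hexablock_def mu_hexablock_def
    using mu_hexa_less_1_if_op_norm_less_1 by blast
  have "hexa_pi separating_matrix \<in> mu_hexablock"
    unfolding mu_hexablock_def using mu_hexa_separating_matrix by blast
  moreover have "hexa_pi separating_matrix \<notin> normed_hexablock"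
  proof
    assume "hexa_pi separating_matrix \<in> normed_hexablock"
    then obtain B where B: "hexa_pi separating_matrix = hexa_pi B" "op_norm B < 1"
      unfolding normed_hexablock_def by blast
    have "separating_matrix = B"
      using B(1) by (rule hexa_pi_inj_if_lower_left_nonzero) (simp add: separating_matrix_nth)
    with B(2) op_norm_separating_matrix_ge_1 show False by simp
  qed
  ultimately show "normed_hexablock \<noteq> mu_hexablock" by blast
qed

end
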